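(* Consider on $\mathbb{C}^3$ the system $$\begin{aligned} \dot z_1&=z_1\left(\lambda+\gamma(|z_1|^2+|z_2|^2+|z_3|^2)+\alpha(|z_2|^2+|z_3|^2)\right)+\bar z_1\beta(z_2^2+z_3^2)\\ \dot z_2&=z_2\left(\lambda+\gamma(|z_1|^2+|z_2|^2+|z_3|^2)+\alpha(|z_1|^2+|z_3|^2)\right)+\bar z_2\beta(z_1^2+z_3^2)\\ \dot z_3&=z_3\left(\lambda+\gamma(|z_1|^2+|z_2|^2+|z_3|^2)+\alpha(|z_1|^2+|z_2|^2)\right)+\bar z_3\beta(z_1^2+z_2^2) \end{aligned}$$ with complex coefficients $\alpha,\beta,\gamma,\lambda$ and $\beta\neq0$. The existence of submaximal solution branches in the invariant subspace $\{(z_1,z_1,z_2)\}$ depends only on the value of $\alpha/\beta$, and there are parameter values for which three submaximal solution branches in this subspace coexist.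
   Context: The system is the cubic truncation of the normal form for vector fields equivariant under the matrix group $G=\Gamma\times\mathbb{S}^1$ acting on $\mathbb{C}^3$, where $\Gamma$ is the group generated by $$R=\begin{bmatrix}1&0&0\\0&-1&0\\0&0&-1\end{bmatrix},\quad C=\begin{bmatrix}0&1&0\\0&0&1\\1&0&0\end{bmatrix},\quad \kappa=\begin{bmatrix}1&0&0\\0&0&1\\0&1&0\end{bmatrix}$$ and $\theta\in\mathbb{S}^1$ acts as multiplication by $e^{i\theta}$. The subspace $\{(z_1,z_1,z_2):z_1,z_2\in\mathbb{C}\}$ is the fixed-point subspace of a conjugate of $\langle\kappa\rangle$, hence flow-invariant. For $\xi=re^{-i\psi}$ with $r>0$, there is a solution branch through $(z,z,\xi z)$ if the complex line $\{(z,z,\xi z):z\in\mathbb{C}\}$ is invariant under the flow, the system restricted to this line being of the form $\dot z=z(\lambda+c|z|^2)$ with $c\in\mathbb{C}$; its nonzero periodic solutions form the branch, created at the Hopf bifurcation when $\lambda$ crosses the imaginary axis. The branch is submaximal if the line is not one of the two-dimensional fixed-point subspaces of isotropy subgroups of $G$, that is, if the isotropy subgroup in $G$ of $(z,z,\xi z)$, $z\ne0$, is exactly the order-two group fixing $\{(z_1,z_1,z_2)\}$. Branches given by $\xi$ and $-\xi$ are conjugate under $G$ and are counted as one, so branches are counted by the pairs $(r,e^{2i\psi})$. *)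

theory Defs
  imports "HOL-Analysis.Analysis" "HOL-Algebra.Generated_Groups"
begin

definition GL3 :: "(complex^3^3) monoid" where
  "GL3 = \<lparr>carrier = {A. invertible A}, mult = (**), one = mat 1\<rparr>"

definition R_mat :: "complex^3^3" where
  "R_mat = vector [vector [1, 0, 0], vector [0, -1, 0], vector [0, 0, -1]]"

definition C_mat :: "complex^3^3" where
  "C_mat = vector [vector [0, 1, 0], vector [0, 0, 1], vector [1, 0, 0]]"

definition kappa_mat :: "complex^3^3" where
  "kappa_mat = vector [vector [1, 0, 0], vector [0, 0, 1], vector [0, 1, 0]]"

definition Gamma :: "(complex^3^3) set" where
  "Gamma = generate GL3 {R_mat, C_mat, kappa_mat}"

text \<open>The circle is represented by the unit complex numbers: the angle \<open>\<theta>\<close> corresponds to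
  \<open>w = cis \<theta>\<close>.\<close>

definition sym_group :: "((complex^3^3) \<times> complex) set" where
  "sym_group = Gamma \<times> sphere 0 1"

definition act :: "(complex^3^3) \<times> complex \<Rightarrow> complex^3 \<Rightarrow> complex^3" where
  "act g v = snd g *s (fst g *v v)"

definition isotropy :: "complex^3 \<Rightarrow> ((complex^3^3) \<times> complex) set" where
  "isotropy v = {g \<in> sym_group. act g v = v}"

definition diag_subspace :: "(complex^3) set" where
  "diag_subspace = {vector [z1, z1, z2] | z1 z2. True}"

definition pointwise_stabilizer :: "(complex^3) set \<Rightarrow> ((complex^3^3) \<times> complex) set" where
  "pointwise_stabilizer S = {g \<in> sym_group. \<forall>v\<in>S. act g v = v}"

text \<open>The linear coefficient \<open>\<lambda>\<close> is called \<open>\<mu>\<close>, as \<open>\<lambda>\<close> is the abstraction binder.\<close>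

definition vfield ::
  "complex \<Rightarrow> complex \<Rightarrow> complex \<Rightarrow> complex \<Rightarrow> complex^3 \<Rightarrow> complex^3" where
  "vfield \<alpha> \<beta> \<gamma> \<mu> z =
    (let n = (\<lambda>i. complex_of_real ((cmod (z $ i))\<^sup>2)); N = n 1 + n 2 + n 3 in
     vector
      [z $ 1 * (\<mu> + \<gamma> * N + \<alpha> * (n 2 + n 3)) + cnj (z $ 1) * \<beta> * ((z $ 2)\<^sup>2 + (z $ 3)\<^sup>2),
       z $ 2 * (\<mu> + \<gamma> * N + \<alpha> * (n 1 + n 3)) + cnj (z $ 2) * \<beta> * ((z $ 1)\<^sup>2 + (z $ 3)\<^sup>2),
       z $ 3 * (\<mu> + \<gamma> * N + \<alpha> * (n 1 + n 2)) + cnj (z $ 3) * \<beta> * ((z $ 1)\<^sup>2 + (z $ 2)\<^sup>2)])"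

definition solves_ode_on ::
  "(complex^3 \<Rightarrow> complex^3) \<Rightarrow> (real \<Rightarrow> complex^3) \<Rightarrow> real set \<Rightarrow> bool" where
  "solves_ode_on F x J \<longleftrightarrow> (\<forall>t\<in>J. (x has_vector_derivative F (x t)) (at t within J))"

definition flow_invariant :: "(complex^3 \<Rightarrow> complex^3) \<Rightarrow> (complex^3) set \<Rightarrow> bool" where
  "flow_invariant F S \<longleftrightarrow>
    (\<forall>J x. is_interval J \<and> 0 \<in> J \<and> solves_ode_on F x J \<and> x 0 \<in> S \<longrightarrow> (\<forall>t\<in>J. x t \<in> S))"

definition line_point :: "complex \<Rightarrow> complex \<Rightarrow> complex^3" where
  "line_point \<xi> z = vector [z, z, \<xi> * z]"

text \<open>The last conjunct says that, in the coordinate \<open>z\<close> on the line, the restricted system is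
  \<open>z' = z (\<mu> + c |z|\<^sup>2)\<close>, since \<open>line_point \<xi>\<close> is linear.\<close>

definition solution_branch ::
  "complex \<Rightarrow> complex \<Rightarrow> complex \<Rightarrow> complex \<Rightarrow> complex \<Rightarrow> bool" where
  "solution_branch \<alpha> \<beta> \<gamma> \<mu> \<xi> \<longleftrightarrow>
     flow_invariant (vfield \<alpha> \<beta> \<gamma> \<mu>) (range (line_point \<xi>)) \<and>
     (\<exists>c. \<forall>z. vfield \<alpha> \<beta> \<gamma> \<mu> (line_point \<xi> z)
             = line_point \<xi> (z * (\<mu> + c * complex_of_real ((cmod z)\<^sup>2))))"

definition submaximal :: "complex \<Rightarrow> bool" where
  "submaximal \<xi> \<longleftrightarrow>
     (\<forall>z. z \<noteq> 0 \<longrightarrow> isotropy (line_point \<xi> z) = pointwise_stabilizer diag_subspace)"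

text \<open>With \<open>\<xi> = r exp (- i \<psi>)\<close>, the pair \<open>(r, exp (2 i \<psi>))\<close> determines \<open>\<xi>\<close> exactly up to sign,
  so each element of the following set is one branch modulo the symmetry \<open>\<xi> \<mapsto> -\<xi>\<close>.\<close>

definition submaximal_branches ::
  "complex \<Rightarrow> complex \<Rightarrow> complex \<Rightarrow> complex \<Rightarrow> (real \<times> complex) set" where
  "submaximal_branches \<alpha> \<beta> \<gamma> \<mu> =
    {(r, cis (2 * \<psi>)) | r \<psi>. r > 0 \<and>
        solution_branch \<alpha> \<beta> \<gamma> \<mu> (complex_of_real r * cis (- \<psi>)) \<and>
        submaximal (complex_of_real r * cis (- \<psi>))}"

end

theory Submission
  imports Defs
begin

text \<open>Comparing the first and third components of the vector field on the line through
  \<open>(1, 1, \<xi>)\<close>, with \<open>u = exp (2 i \<psi>)\<close>, gives the single equation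
  \<open>(\<alpha> / \<beta>) (1 - r\<^sup>2) = 1 + r\<^sup>2 cnj u - 2 u\<close>, in which \<open>\<gamma>\<close> and \<open>\<lambda>\<close> cancel.
  Given this equation, the line is invariant by Gronwall's inequality.
  If \<open>r = 1\<close> the equation forces \<open>u = 1\<close>, hence \<open>\<xi> = \<plusminus>1\<close>, a maximal branch; if \<open>r \<noteq> 1\<close> every
  element of the isotropy subgroup fixes the third coordinate axis, so the branch is submaximal.
  Eliminating \<open>u\<close> through \<open>|u| = 1\<close> leaves a quartic in \<open>r\<^sup>2\<close> with the spurious root \<open>1\<close>;
  for a suitable \<open>\<alpha> / \<beta>\<close> the remaining three roots are positive, distinct and different from \<open>1\<close>.\<close>

section \<open>Invariance of linear subspaces under locally Lipschitz flows\<close>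

text \<open>By Cauchy-Schwarz the weighted square norm \<open>\<phi>\<close> has nonpositive
  derivative, so it cannot rise from its initial value 0.\<close>

lemma gronwall_zero:
  fixes w :: "real \<Rightarrow> 'a::real_inner"
  assumes der: "\<And>t. t \<in> {0..1} \<Longrightarrow> (w has_vector_derivative w' t) (at t within {0..1})"
    and bound: "\<And>t. t \<in> {0..1} \<Longrightarrow> norm (w' t) \<le> K * norm (w t)"
    and init: "w 0 = 0"
  shows "w 1 = 0"
proof -
  define \<phi> where "\<phi> = (\<lambda>t. (w t \<bullet> w t) * exp (- (2 * K * t)))"
  have "\<phi> 1 \<le> \<phi> 0"
  proof (rule DERIV_nonpos_imp_decreasing_open[of 0 1])
    show "(0::real) \<le> 1" by simp
  next
    fix t :: real assume t: "0 < t" "t < 1"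
    then have at: "at t within {0..1} = at t"
      by (intro at_within_interior) (simp add: interior_atLeastAtMost_real)
    have d: "(w has_derivative (\<lambda>h. h *\<^sub>R w' t)) (at t)"
      using der[of t] t by (simp add: at has_vector_derivative_def)
    have "((\<lambda>t. w t \<bullet> w t) has_derivative (\<lambda>h. w t \<bullet> (h *\<^sub>R w' t) + (h *\<^sub>R w' t) \<bullet> w t)) (at t)"
      by (rule has_derivative_inner[OF d d])
    then have "((\<lambda>t. w t \<bullet> w t) has_field_derivative 2 * (w t \<bullet> w' t)) (at t)"
      by (rule has_derivative_imp_has_field_derivative) (simp add: inner_commute)
    then have "(\<phi> has_field_derivative
        2 * (w t \<bullet> w' t - K * (w t \<bullet> w t)) * exp (- (2 * K * t))) (at t)"
      unfolding \<phi>_def by (auto intro!: derivative_eq_intros simp: algebra_simps)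
    moreover have "w t \<bullet> w' t \<le> K * (w t \<bullet> w t)"
    proof -
      have "w t \<bullet> w' t \<le> norm (w t) * norm (w' t)" by (rule norm_cauchy_schwarz)
      also have "\<dots> \<le> norm (w t) * (K * norm (w t))"
        using bound[of t] t by (intro mult_left_mono) auto
      finally show ?thesis by (simp add: dot_square_norm power2_eq_square algebra_simps)
    qed
    ultimately show "\<exists>y. (\<phi> has_real_derivative y) (at t) \<and> y \<le> 0"
      by (intro exI conjI) (auto simp: mult_le_0_iff)
  next
    have "continuous_on {0..1} w"
      using der by (meson continuous_on_eq_continuous_within has_vector_derivative_continuous)
    then show "continuous_on {0..1} \<phi>"
      unfolding \<phi>_def by (intro continuous_intros)
  qed
  then have "w 1 \<bullet> w 1 \<le> 0"
    by (simp add: \<phi>_def init mult_le_0_iff)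
  then show ?thesis by (metis inner_eq_zero_iff inner_ge_zero order_antisym)
qed

text \<open>\<open>Q v = v - P v\<close> measures the departure from the subspace. It kills
  \<open>F (P y)\<close>, so \<open>Q (F y) = Q (F y - F (P y))\<close>, which the Lipschitz bound
  controls by a multiple of \<open>norm (Q y)\<close>; then \<open>gronwall_zero\<close>
  applies.\<close>

lemma flow_invariant_range_projection:
  fixes F :: "complex^3 \<Rightarrow> complex^3"
  assumes P: "linear P" and proj: "\<And>v. P (P v) = P v"
    and tangent: "\<And>v. P (F (P v)) = F (P v)"
    and lip: "\<And>B. \<exists>L. L-lipschitz_on (cball 0 B) F"
  shows "flow_invariant F (range P)"
  unfolding flow_invariant_def
proof (intro allI impI ballI)
  fix J x t
  assume H: "is_interval J \<and> 0 \<in> J \<and> solves_ode_on F x J \<and> x 0 \<in> range P" and t: "t \<in> J"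
  \<comment> \<open>Rescaling time by \<open>t\<close>, of either sign, treats forward and backward solutions at once.\<close>
  have sub: "(\<lambda>s. t * s) ` {0..1} \<subseteq> J"
  proof (rule image_subsetI)
    fix s :: real assume "s \<in> {0..1}"
    moreover have "convex J" using H by (simp add: is_interval_convex)
    ultimately have "(1 - s) *\<^sub>R 0 + s *\<^sub>R t \<in> J"
      using H t by (intro convexD) auto
    then show "t * s \<in> J" by (simp add: mult.commute)
  qed
  define y where "y = (\<lambda>s. x (t * s))"
  have dy: "(y has_vector_derivative t *\<^sub>R F (y s)) (at s within {0..1})" if s: "s \<in> {0..1}" for s
  proof -
    have g: "((\<lambda>s. t * s) has_vector_derivative t) (at s within {0..1})"
      by (auto intro!: derivative_eq_intros)
    have "(x has_vector_derivative F (x (t * s))) (at (t * s) within J)"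
      using H sub s unfolding solves_ode_on_def by blast
    then have "(x has_vector_derivative F (x (t * s))) (at (t * s) within (\<lambda>s. t * s) ` {0..1})"
      using sub by (rule has_vector_derivative_within_subset)
    from vector_diff_chain_within[OF g this] show ?thesis
      by (simp add: y_def o_def)
  qed
  have "continuous_on {0..1} y"
    using dy by (meson continuous_on_eq_continuous_within has_vector_derivative_continuous)
  moreover have "continuous_on UNIV P"
    using P by (simp add: linear_continuous_on linear_conv_bounded_linear)
  ultimately have "compact (y ` {0..1})" "compact (P ` y ` {0..1})"
    by (auto intro!: compact_continuous_image intro: continuous_on_subset)
  \<comment> \<open>Lipschitz constants are available only on balls, so one ball must hold both the
    solution and its projection.\<close>
  then have "bounded (y ` {0..1} \<union> P ` y ` {0..1})"
    by (simp add: compact_imp_bounded)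
  then obtain B where B: "\<And>v. v \<in> y ` {0..1} \<union> P ` y ` {0..1} \<Longrightarrow> norm v \<le> B"
    unfolding bounded_iff by blast
  obtain L where L: "L-lipschitz_on (cball 0 B) F" using lip by blast
  define Q where "Q = (\<lambda>v. v - P v)"
  have Q: "bounded_linear Q"
    using P unfolding Q_def
    by (intro bounded_linear_sub bounded_linear_ident) (simp add: linear_conv_bounded_linear)
  obtain M where M: "M > 0" "\<And>v. norm (Q v) \<le> norm v * M"
    using bounded_linear.pos_bounded[OF Q] by blast
  have "Q (y 1) = 0"
  proof (rule gronwall_zero[where w = "\<lambda>s. Q (y s)"])
    fix s :: real assume s: "s \<in> {0..1}"
    show "((\<lambda>s. Q (y s)) has_vector_derivative Q (t *\<^sub>R F (y s))) (at s within {0..1})"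
      using bounded_linear.has_vector_derivative[OF Q dy[OF s]] .
    have "Q (F (P (y s))) = 0" by (simp add: Q_def tangent)
    then have "Q (t *\<^sub>R F (y s)) = t *\<^sub>R Q (F (y s) - F (P (y s)))"
      using linear_diff[OF bounded_linear.linear[OF Q]] linear_cmul[OF bounded_linear.linear[OF Q]]
      by simp
    then have "norm (Q (t *\<^sub>R F (y s))) \<le> \<bar>t\<bar> * (norm (F (y s) - F (P (y s))) * M)"
      using M(2) by (simp add: mult_left_mono)
    also have "\<dots> \<le> \<bar>t\<bar> * ((L * norm (y s - P (y s))) * M)"
      using B s M(1)
      by (intro mult_left_mono mult_right_mono lipschitz_on_normD[OF L]) auto
    finally show "norm (Q (t *\<^sub>R F (y s))) \<le> (\<bar>t\<bar> * L * M) * norm (Q (y s))"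
      by (simp add: Q_def mult_ac)
  next
    show "Q (y 0) = 0" using H proj by (auto simp: Q_def y_def)
  qed
  then have "x t = P (x t)" by (simp add: Q_def y_def)
  then show "x t \<in> range P" by (metis rangeI)
qed

section \<open>Lipschitz bounds for the cubic field on balls\<close>

text \<open>Boundedness is carried along because Lipschitz functions alone are not closed under
  products.\<close>

definition bounded_lipschitz :: "'a::metric_space set \<Rightarrow> ('a \<Rightarrow> complex) \<Rightarrow> bool" where
  "bounded_lipschitz S f \<longleftrightarrow> bounded (f ` S) \<and> (\<exists>L. L-lipschitz_on S f)"

lemma bounded_lipschitz_const: "bounded_lipschitz S (\<lambda>x. c)"
  unfolding bounded_lipschitz_def
  using lipschitz_on_constant by (auto simp: bounded_iff)

lemma bounded_lipschitz_add:
  assumes "bounded_lipschitz S f" "bounded_lipschitz S g"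
  shows "bounded_lipschitz S (\<lambda>x. f x + g x)"
proof -
  have "bounded ((\<lambda>x. f x + g x) ` S)"
    using assms unfolding bounded_lipschitz_def by (intro bounded_plus_comp) auto
  then show ?thesis
    using assms lipschitz_on_add unfolding bounded_lipschitz_def by blast
qed

lemma bounded_lipschitz_mult:
  assumes "bounded_lipschitz S f" "bounded_lipschitz S g"
  shows "bounded_lipschitz S (\<lambda>x. f x * g x)"
proof -
  obtain L M where L: "L-lipschitz_on S f" and M: "M-lipschitz_on S g"
    using assms unfolding bounded_lipschitz_def by blast
  obtain A B where A: "A > 0" "\<And>x. x \<in> S \<Longrightarrow> norm (f x) \<le> A"
    and B: "B > 0" "\<And>x. x \<in> S \<Longrightarrow> norm (g x) \<le> B"
    using assms unfolding bounded_lipschitz_def bounded_pos by auto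
  have "norm (f x * g x) \<le> A * B" if "x \<in> S" for x
    using A B that by (simp add: norm_mult mult_mono)
  then have "bounded ((\<lambda>x. f x * g x) ` S)" by (auto simp: bounded_iff)
  moreover have "(A * M + L * B)-lipschitz_on S (\<lambda>x. f x * g x)"
  proof (rule lipschitz_onI)
    show "0 \<le> A * M + L * B"
      using A(1) B(1) lipschitz_on_nonneg[OF L] lipschitz_on_nonneg[OF M] by simp
    fix x y assume S: "x \<in> S" "y \<in> S"
    have "f x * g x - f y * g y = f x * (g x - g y) + (f x - f y) * g y"
      by (simp add: algebra_simps)
    then have "dist (f x * g x) (f y * g y) \<le> norm (f x) * dist (g x) (g y) + dist (f x) (f y) * norm (g y)"
      by (metis dist_norm norm_mult norm_triangle_ineq)
    also have "\<dots> \<le> A * (M * dist x y) + (L * dist x y) * B"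
      using S A B lipschitz_onD[OF L] lipschitz_onD[OF M] lipschitz_on_nonneg[OF L]
      by (intro add_mono mult_mono) auto
    finally show "dist (f x * g x) (f y * g y) \<le> (A * M + L * B) * dist x y"
      by (simp add: algebra_simps)
  qed
  ultimately show ?thesis unfolding bounded_lipschitz_def by blast
qed

lemma bounded_lipschitz_cnj:
  assumes "bounded_lipschitz S f"
  shows "bounded_lipschitz S (\<lambda>x. cnj (f x))"
  using assms unfolding bounded_lipschitz_def lipschitz_on_def bounded_iff dist_norm
  by (simp flip: complex_cnj_diff)

lemma bounded_lipschitz_component: "bounded_lipschitz (cball 0 B) (\<lambda>z :: complex^3. z $ i)"
proof -
  have "norm (z $ i) \<le> B" if "norm z \<le> B" for z :: "complex^3"
    using Finite_Cartesian_Product.norm_nth_le[of z i] that by linarith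
  moreover have "1-lipschitz_on (cball 0 B) (\<lambda>z :: complex^3. z $ i)"
    by (rule lipschitz_onI) (simp_all add: dist_vec_nth_le)
  ultimately show ?thesis unfolding bounded_lipschitz_def bounded_iff by fastforce
qed

lemmas bounded_lipschitz_intros =
  bounded_lipschitz_const bounded_lipschitz_add bounded_lipschitz_mult
  bounded_lipschitz_cnj bounded_lipschitz_component

lemma lipschitz_on_vec3:
  fixes F :: "'a::metric_space \<Rightarrow> complex^3"
  assumes "\<And>i :: 3. \<exists>L. L-lipschitz_on S (\<lambda>x. F x $ i)"
  shows "\<exists>L. L-lipschitz_on S F"
proof -
  obtain L where L: "\<And>i :: 3. (L i)-lipschitz_on S (\<lambda>x. F x $ i)" using assms by metis
  have "(\<Sum>i\<in>UNIV. L i)-lipschitz_on S F"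
  proof (rule lipschitz_onI)
    show "0 \<le> (\<Sum>i\<in>UNIV. L i)" using lipschitz_on_nonneg[OF L] by (intro sum_nonneg)
    fix x y assume S: "x \<in> S" "y \<in> S"
    have "dist (F x) (F y) \<le> (\<Sum>i\<in>UNIV. dist (F x $ i) (F y $ i))"
      unfolding dist_vec_def by (rule L2_set_le_sum) simp
    also have "\<dots> \<le> (\<Sum>i\<in>UNIV. L i * dist x y)"
      using lipschitz_onD[OF L] S by (intro sum_mono) auto
    finally show "dist (F x) (F y) \<le> (\<Sum>i\<in>UNIV. L i) * dist x y"
      by (simp add: sum_distrib_right)
  qed
  then show ?thesis by blast
qed

lemma vfield_lipschitz: "\<exists>L. L-lipschitz_on (cball 0 B) (vfield \<alpha> \<beta> \<gamma> \<mu>)"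
proof (rule lipschitz_on_vec3)
  fix i :: 3
  \<comment> \<open>This turns every component into a polynomial in the coordinates and their
    conjugates.\<close>
  have n: "complex_of_real ((cmod z)\<^sup>2) = z * cnj z" for z
    by (rule complex_norm_square)
  have "bounded_lipschitz (cball 0 B) (\<lambda>z. vfield \<alpha> \<beta> \<gamma> \<mu> z $ i)"
    unfolding vfield_def Let_def n unfolding power2_eq_square
    using exhaust_3[of i] by (elim disjE) (simp_all add: bounded_lipschitz_intros)
  then show "\<exists>L. L-lipschitz_on (cball 0 B) (\<lambda>z. vfield \<alpha> \<beta> \<gamma> \<mu> z $ i)"
    unfolding bounded_lipschitz_def by blast
qed

section \<open>The branching equation\<close>

lemma vec3_eq_iff: "(v :: 'a^3) = w \<longleftrightarrow> v $ 1 = w $ 1 \<and> v $ 2 = w $ 2 \<and> v $ 3 = w $ 3"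
  by (simp add: vec_eq_iff forall_3)

text \<open>The first two components of the field on the line agree and fix the coefficient
  \<open>c\<close>, which absorbs \<open>\<gamma>\<close>. The third is \<open>\<xi>\<close> times
  the first plus a defect proportional to the difference of the two sides of the equation.\<close>

lemma solution_branch_iff:
  assumes "\<beta> \<noteq> 0"
  shows "solution_branch \<alpha> \<beta> \<gamma> \<mu> \<xi> \<longleftrightarrow>
    \<alpha> / \<beta> * (1 - complex_of_real ((cmod \<xi>)\<^sup>2)) * \<xi> + 2 * cnj \<xi> = \<xi> * (1 + \<xi>\<^sup>2)"
    (is "_ \<longleftrightarrow> ?E")
proof -
  let ?F = "vfield \<alpha> \<beta> \<gamma> \<mu>"
  let ?N = "\<lambda>z. complex_of_real ((cmod z)\<^sup>2)"
  define c where "c = \<gamma> * (2 + ?N \<xi>) + \<alpha> * (1 + ?N \<xi>) + \<beta> * (1 + \<xi>\<^sup>2)"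
  have n: "?N z = z * cnj z" for z by (rule complex_norm_square)
  have F12: "?F (line_point \<xi> z) $ 1 = z * (\<mu> + c * ?N z)"
      "?F (line_point \<xi> z) $ 2 = z * (\<mu> + c * ?N z)" for z
    unfolding n c_def vfield_def Let_def line_point_def
    by (simp_all add: algebra_simps power2_eq_square)
  have F3: "?F (line_point \<xi> z) $ 3 = \<xi> * (z * (\<mu> + c * ?N z)) +
      z * ?N z * \<beta> * (\<alpha> / \<beta> * (1 - ?N \<xi>) * \<xi> + 2 * cnj \<xi> - \<xi> * (1 + \<xi>\<^sup>2))" for z
  proof -
    have "?F (line_point \<xi> z) $ 3 = \<xi> * (z * (\<mu> + c * ?N z)) +
      z * ?N z * ((\<alpha> * (1 - ?N \<xi>)) * \<xi> + \<beta> * (2 * cnj \<xi> - \<xi> * (1 + \<xi>\<^sup>2)))"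
      unfolding n c_def vfield_def Let_def line_point_def
      by (simp add: algebra_simps power2_eq_square)
    also have "(\<alpha> * (1 - ?N \<xi>)) * \<xi> + \<beta> * (2 * cnj \<xi> - \<xi> * (1 + \<xi>\<^sup>2)) =
      \<beta> * (\<alpha> / \<beta> * (1 - ?N \<xi>) * \<xi> + 2 * cnj \<xi> - \<xi> * (1 + \<xi>\<^sup>2))"
      using assms by (simp add: algebra_simps)
    finally show ?thesis by (simp only: mult.assoc)
  qed
  have inv: "?F (line_point \<xi> z) = line_point \<xi> (z * (\<mu> + c * ?N z))" if ?E for z
    using that F12[of z] F3[of z] by (simp add: vec3_eq_iff line_point_def del: of_real_power)
  have "flow_invariant ?F (range (line_point \<xi>))" if ?E
  proof -
    \<comment> \<open>The projection onto the line along the plane of vectors with first coordinate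
      0.\<close>
    define P where "P = (\<lambda>v :: complex^3. line_point \<xi> (v $ 1))"
    have "linear P"
      by (rule linearI) (simp_all add: P_def vec3_eq_iff line_point_def algebra_simps)
    then have "flow_invariant ?F (range P)"
      by (rule flow_invariant_range_projection)
        (simp_all add: P_def inv[OF that] vfield_lipschitz, simp_all add: line_point_def)
    moreover have "range P = range (line_point \<xi>)"
    proof
      show "range (line_point \<xi>) \<subseteq> range P"
      proof
        fix v assume "v \<in> range (line_point \<xi>)"
        then obtain z where "v = line_point \<xi> z" by blast
        then have "v = P (line_point \<xi> z)" by (simp add: P_def line_point_def)
        then show "v \<in> range P" by blast
      qed
    qed (auto simp: P_def)
    ultimately show ?thesis by simp
  qed
  \<comment> \<open>Evaluation at \<open>z = 1\<close> is enough: the first component identifies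
    \<open>d\<close> with \<open>c\<close>, and the third then forces the defect to vanish.\<close>
  moreover have ?E if d: "\<forall>z. ?F (line_point \<xi> z) = line_point \<xi> (z * (\<mu> + d * ?N z))" for d
  proof -
    have e: "?F (line_point \<xi> 1) = line_point \<xi> (1 * (\<mu> + d * ?N 1))"
      using d by blast
    then have "c = d" using F12(1)[of 1] by (simp add: line_point_def)
    then show ?E using assms e F3[of 1] by (simp add: line_point_def del: of_real_power)
  qed
  ultimately show ?thesis
    using inv unfolding solution_branch_def by blast
qed

text \<open>Division by \<open>\<xi> \<noteq> 0\<close>: with \<open>u = cis (2 * \<psi>)\<close>
  one has \<open>cnj \<xi> = \<xi> * u\<close> and \<open>\<xi>^2 = r^2 * cnj u\<close>.\<close>

lemma solution_branch_polar_iff: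
  assumes "\<beta> \<noteq> 0" "r > 0"
  shows "solution_branch \<alpha> \<beta> \<gamma> \<mu> (complex_of_real r * cis (- \<psi>)) \<longleftrightarrow>
    \<alpha> / \<beta> * (1 - (complex_of_real r)\<^sup>2) = 1 + (complex_of_real r)\<^sup>2 * cnj (cis (2 * \<psi>)) - 2 * cis (2 * \<psi>)"
    (is "_ \<longleftrightarrow> ?E")
proof -
  let ?\<xi> = "complex_of_real r * cis (- \<psi>)"
  have nz: "?\<xi> \<noteq> 0" using assms by simp
  have m: "(cmod ?\<xi>)\<^sup>2 = r\<^sup>2" by (simp add: norm_mult)
  have c: "cnj ?\<xi> = ?\<xi> * cis (2 * \<psi>)" by (simp add: cis_cnj cis_mult mult.assoc)
  have s: "?\<xi>\<^sup>2 = (complex_of_real r)\<^sup>2 * cnj (cis (2 * \<psi>))"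
    by (simp add: power_mult_distrib cis_cnj power2_eq_square cis_mult)
  have "\<alpha> / \<beta> * (1 - (complex_of_real r)\<^sup>2) * ?\<xi> + 2 * cnj ?\<xi> - ?\<xi> * (1 + ?\<xi>\<^sup>2) =
    ?\<xi> * (\<alpha> / \<beta> * (1 - (complex_of_real r)\<^sup>2) -
      (1 + (complex_of_real r)\<^sup>2 * cnj (cis (2 * \<psi>)) - 2 * cis (2 * \<psi>)))"
    unfolding c s by (simp add: algebra_simps)
  then show ?thesis
    unfolding solution_branch_iff[OF assms(1)] m of_real_power using nz
    by (simp only: eq_iff_diff_eq_0[of "_ + _" "_ * _"] mult_eq_0_iff simp_thms
        right_minus_eq)
qed

section \<open>Isotropy subgroups\<close>

lemma group_GL3: "group GL3"
proof (rule groupI)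
  fix A assume "A \<in> carrier GL3"
  then obtain B where "A ** B = mat 1" "B ** A = mat 1"
    by (auto simp: GL3_def invertible_def)
  then show "\<exists>B\<in>carrier GL3. B \<otimes>\<^bsub>GL3\<^esub> A = \<one>\<^bsub>GL3\<^esub>"
    by (auto simp: GL3_def invertible_def)
next
  show "\<one>\<^bsub>GL3\<^esub> \<in> carrier GL3"
    by (auto simp: GL3_def invertible_def intro!: exI[of _ "mat 1"])
qed (auto simp: GL3_def invertible_mult matrix_mul_assoc)

lemma GL3_inv_eq:
  assumes "A ** B = mat 1" "B ** A = mat 1"
  shows "inv\<^bsub>GL3\<^esub> A = B"
proof -
  have "A \<in> carrier GL3" "B \<in> carrier GL3"
    using assms by (auto simp: GL3_def invertible_def)
  then show ?thesis
    using group.inv_equality[OF group_GL3, of B A] assms by (simp add: GL3_def)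
qed

lemma generator_mult_vec:
  "R_mat *v x = vector [x $ 1, - x $ 2, - x $ 3]"
  "C_mat *v x = vector [x $ 2, x $ 3, x $ 1]"
  "kappa_mat *v x = vector [x $ 1, x $ 3, x $ 2]"
  by (simp_all add: vec3_eq_iff matrix_vector_mult_def sum_3 R_mat_def C_mat_def kappa_mat_def)

text \<open>\<open>generate\<close> also admits inverses of generators; these identities reduce that
  case to products. \<open>R_mat\<close> and \<open>kappa_mat\<close> are involutions,
  \<open>C_mat\<close> has order three.\<close>

lemma generator_invs:
  "inv\<^bsub>GL3\<^esub> R_mat = R_mat" "inv\<^bsub>GL3\<^esub> C_mat = C_mat ** C_mat"
  "inv\<^bsub>GL3\<^esub> kappa_mat = kappa_mat"
proof -
  have "R_mat ** R_mat = mat 1" "C_mat ** (C_mat ** C_mat) = mat 1" "kappa_mat ** kappa_mat = mat 1"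
    unfolding matrix_eq
    by (simp_all add: generator_mult_vec vec3_eq_iff flip: matrix_vector_mul_assoc)
  then show "inv\<^bsub>GL3\<^esub> R_mat = R_mat" "inv\<^bsub>GL3\<^esub> C_mat = C_mat ** C_mat"
    "inv\<^bsub>GL3\<^esub> kappa_mat = kappa_mat"
    by (auto intro!: GL3_inv_eq simp: matrix_mul_assoc)
qed

text \<open>An invariant of the generators that is stable under products and replaces an enumeration
  of \<open>Gamma\<close>: coordinates are permuted and multiplied by phases.\<close>

definition unimodular_monomial :: "complex^3^3 \<Rightarrow> bool" where
  "unimodular_monomial A \<longleftrightarrow> (\<exists>\<sigma> \<epsilon>. inj \<sigma> \<and> (\<forall>i. cmod (\<epsilon> i) = 1) \<and>
     (\<forall>x i. (A *v x) $ i = \<epsilon> i * x $ \<sigma> i))"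

lemma unimodular_monomial_mult:
  assumes "unimodular_monomial A" "unimodular_monomial B"
  shows "unimodular_monomial (A ** B)"
proof -
  obtain \<sigma> \<epsilon> \<sigma>' \<epsilon>' where
    A: "inj \<sigma>" "\<forall>i. cmod (\<epsilon> i) = 1" "\<forall>x i. (A *v x) $ i = \<epsilon> i * x $ \<sigma> i" and
    B: "inj \<sigma>'" "\<forall>i. cmod (\<epsilon>' i) = 1" "\<forall>x i. (B *v x) $ i = \<epsilon>' i * x $ \<sigma>' i"
    using assms unfolding unimodular_monomial_def by metis
  show ?thesis
    unfolding unimodular_monomial_def
    using A B inj_compose[OF B(1) A(1)]
    by (intro exI[of _ "\<sigma>' \<circ> \<sigma>"] exI[of _ "\<lambda>i. \<epsilon> i * \<epsilon>' (\<sigma> i)"])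
      (simp add: norm_mult flip: matrix_vector_mul_assoc)
qed

lemma unimodular_monomialI:
  assumes "inj \<sigma>" "\<And>i. cmod (\<epsilon> i) = 1" "\<And>x i. (A *v x) $ i = \<epsilon> i * x $ \<sigma> i"
  shows "unimodular_monomial A"
  using assms unfolding unimodular_monomial_def by blast

lemma unimodular_monomial_generators:
  "unimodular_monomial R_mat" "unimodular_monomial C_mat" "unimodular_monomial kappa_mat"
proof -
  have "(R_mat *v x) $ i = (if i = 1 then 1 else - 1) * x $ id i" for x i
    using exhaust_3[of i] by (auto simp: generator_mult_vec)
  then show "unimodular_monomial R_mat"
    by (rule unimodular_monomialI[rotated -1]) simp_all
  \<comment> \<open>The cycle 1 to 2 to 3 to 1, written with transpositions so that injectivity
    follows by composition.\<close>
  let ?\<sigma> = "Transposition.transpose 1 2 \<circ> Transposition.transpose 2 (3 :: 3)"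
  show "unimodular_monomial C_mat"
  proof (rule unimodular_monomialI[of ?\<sigma> "\<lambda>i. 1"])
    show "(C_mat *v x) $ i = 1 * x $ ?\<sigma> i" for x i
      using exhaust_3[of i] by (auto simp: generator_mult_vec Transposition.transpose_def)
  qed (auto intro: inj_compose)
  show "unimodular_monomial kappa_mat"
  proof (rule unimodular_monomialI[of "Transposition.transpose 2 3" "\<lambda>i. 1"])
    show "(kappa_mat *v x) $ i = 1 * x $ (Transposition.transpose 2 3 i)" for x i
      using exhaust_3[of i] by (auto simp: generator_mult_vec)
  qed simp_all
qed

lemma Gamma_unimodular_monomial: "A \<in> Gamma \<Longrightarrow> unimodular_monomial A"
  unfolding Gamma_def
proof (induction rule: generate.induct)
  case one
  show ?case
    by (rule unimodular_monomialI[of id "\<lambda>i. 1"]) (simp_all add: GL3_def)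
next
  case (incl h)
  then show ?case using unimodular_monomial_generators by blast
next
  case (inv h)
  then show ?case
    using unimodular_monomial_generators unimodular_monomial_mult by (auto simp: generator_invs)
next
  case (eng h1 h2)
  then show ?case by (simp add: GL3_def unimodular_monomial_mult)
qed

text \<open>The third entry of the point differs in modulus from the other two, so a monomial
  symmetry keeps the third axis and at most swaps the first two.\<close>

lemma submaximal_if_norm_ne_1:
  assumes \<xi>: "\<xi> \<noteq> 0" "cmod \<xi> \<noteq> 1"
  shows "submaximal \<xi>"
  unfolding submaximal_def
proof (intro allI impI equalityI subsetI)
  fix z :: complex and g
  assume z: "z \<noteq> 0" and g: "g \<in> isotropy (line_point \<xi> z)"
  obtain A w where Aw: "g = (A, w)" by fastforce
  have A: "A \<in> Gamma" and w: "cmod w = 1" and fix_pt: "w *s (A *v line_point \<xi> z) = line_point \<xi> z"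
    using g by (auto simp: Aw isotropy_def sym_group_def act_def)
  obtain \<sigma> \<epsilon> where \<sigma>: "inj \<sigma>" and \<epsilon>: "\<And>i. cmod (\<epsilon> i) = 1"
    and Ax: "\<And>x i. (A *v x) $ i = \<epsilon> i * x $ \<sigma> i"
    using Gamma_unimodular_monomial[OF A] unfolding unimodular_monomial_def by metis
  have e: "w * (\<epsilon> i * line_point \<xi> z $ \<sigma> i) = line_point \<xi> z $ i" for i
    using fix_pt by (metis Ax vector_smult_component)
  have "cmod (line_point \<xi> z $ \<sigma> 3) = cmod \<xi> * cmod z"
    using arg_cong[OF e[of 3], of cmod] w \<epsilon> by (simp add: norm_mult line_point_def)
  then have \<sigma>3: "\<sigma> 3 = 3"
    using exhaust_3[of "\<sigma> 3"] \<xi> z by (auto simp: line_point_def)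
  have \<sigma>12: "\<sigma> i \<noteq> 3" if "i \<noteq> 3" for i
    using that \<sigma> \<sigma>3 by (metis injD)
  have d3: "line_point \<xi> z $ i \<noteq> 0" "i \<noteq> 3 \<Longrightarrow> line_point \<xi> z $ i = z" for i
    using exhaust_3[of i] \<xi> z by (auto simp: line_point_def)
  \<comment> \<open>\<open>\<sigma>\<close> maps each index to one with the same nonzero entry,
    which cancels and leaves total phase 1.\<close>
  have we: "w * \<epsilon> i = 1" for i
  proof -
    have "line_point \<xi> z $ \<sigma> i = line_point \<xi> z $ i"
      using \<sigma>3 \<sigma>12 d3(2) by metis
    then have "(w * \<epsilon> i) * line_point \<xi> z $ i = 1 * line_point \<xi> z $ i"
      using e[of i] by (simp add: mult.assoc)
    then show ?thesis using d3(1) by simp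
  qed
  have "act g v = v" if "v \<in> diag_subspace" for v
  proof -
    \<comment> \<open>Only the indices 1 and 2 can be swapped, and there \<open>v\<close> has equal
      entries.\<close>
    have "v $ \<sigma> i = v $ i" for i
    proof (cases "i = 3")
      case False
      then show ?thesis
        using that \<sigma>12[of i] exhaust_3[of i] exhaust_3[of "\<sigma> i"]
        by (auto simp: diag_subspace_def)
    qed (simp add: \<sigma>3)
    then have "act g v $ i = v $ i" for i
      by (simp add: Aw act_def Ax we flip: mult.assoc)
    then show ?thesis by (simp add: vec_eq_iff)
  qed
  then show "g \<in> pointwise_stabilizer diag_subspace"
    using g by (simp add: isotropy_def pointwise_stabilizer_def)
next
  fix z g assume "g \<in> pointwise_stabilizer diag_subspace"
  then show "g \<in> isotropy (line_point \<xi> z)"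
    unfolding pointwise_stabilizer_def isotropy_def line_point_def diag_subspace_def by blast
qed

text \<open>An extra symmetry exists: \<open>C_mat\<close> fixes (1, 1, 1), and
  \<open>R_mat ** C_mat\<close> fixes (1, 1, -1).\<close>

lemma not_submaximal_if_square_eq_1:
  assumes "\<xi>\<^sup>2 = 1"
  shows "\<not> submaximal \<xi>"
proof
  assume sub: "submaximal \<xi>"
  have R: "R_mat \<in> Gamma" and C: "C_mat \<in> Gamma"
    unfolding Gamma_def by (auto intro: generate.incl)
  then have RC: "R_mat ** C_mat \<in> Gamma"
    using generate.eng[of R_mat GL3 _ C_mat] unfolding Gamma_def by (simp add: GL3_def)
  have "C_mat *v line_point 1 1 = line_point 1 1"
    "(R_mat ** C_mat) *v line_point (- 1) 1 = line_point (- 1) 1"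
    by (simp_all add: vec3_eq_iff line_point_def generator_mult_vec flip: matrix_vector_mul_assoc)
  moreover have "\<xi> = 1 \<or> \<xi> = - 1" using assms by (simp add: power2_eq_1_iff)
  ultimately obtain A where A: "A = C_mat \<or> A = R_mat ** C_mat"
    and fixed: "A *v line_point \<xi> 1 = line_point \<xi> 1"
    by blast
  then have "(A, 1) \<in> isotropy (line_point \<xi> 1)"
    using A C RC by (auto simp: isotropy_def sym_group_def act_def)
  then have "(A, 1) \<in> pointwise_stabilizer diag_subspace"
    using sub unfolding submaximal_def by auto
  \<comment> \<open>A test vector that neither matrix fixes: both images have second coordinate
    0.\<close>
  moreover have "vector [1, 1, 0] \<in> diag_subspace"
    unfolding diag_subspace_def by blast
  ultimately have "A *v vector [1, 1, 0] = vector [1, 1, 0]"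
    by (auto simp: pointwise_stabilizer_def act_def)
  then have "(A *v vector [1, 1, 0]) $ 2 = 1" by simp
  with A show False
    by (auto simp: generator_mult_vec simp flip: matrix_vector_mul_assoc)
qed

section \<open>Counting submaximal branches\<close>

text \<open>Only the quotient \<open>\<alpha> / \<beta>\<close> survives here, which yields the
  first half of the theorem; the second half becomes a count of pairs \<open>(r, u)\<close>.\<close>

lemma submaximal_branches_eq:
  assumes "\<beta> \<noteq> 0"
  shows "submaximal_branches \<alpha> \<beta> \<gamma> \<mu> = {(r, u). r > 0 \<and> r \<noteq> 1 \<and> cmod u = 1 \<and>
    \<alpha> / \<beta> * (1 - (complex_of_real r)\<^sup>2) = 1 + (complex_of_real r)\<^sup>2 * cnj u - 2 * u}"
    (is "_ = ?S")
proof (intro equalityI subsetI)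
  fix p assume "p \<in> submaximal_branches \<alpha> \<beta> \<gamma> \<mu>"
  then obtain r \<psi> where p: "p = (r, cis (2 * \<psi>))" and r: "r > 0"
    and branch: "solution_branch \<alpha> \<beta> \<gamma> \<mu> (complex_of_real r * cis (- \<psi>))"
    and sub: "submaximal (complex_of_real r * cis (- \<psi>))"
    unfolding submaximal_branches_def by blast
  have eq: "\<alpha> / \<beta> * (1 - (complex_of_real r)\<^sup>2) =
      1 + (complex_of_real r)\<^sup>2 * cnj (cis (2 * \<psi>)) - 2 * cis (2 * \<psi>)"
    using branch solution_branch_polar_iff[OF assms r] by blast
  have "r \<noteq> 1"
  proof
    assume "r = 1"
    \<comment> \<open>At \<open>r = 1\<close> the left side vanishes; the real part gives
      \<open>1 - cos (2 * \<psi>) = 0\<close>, the imaginary part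
      \<open>- 3 * sin (2 * \<psi>) = 0\<close>.\<close>
    then have "1 + cnj (cis (2 * \<psi>)) - 2 * cis (2 * \<psi>) = 0" using eq by simp
    then have "1 - cos (2 * \<psi>) = 0" "sin (2 * \<psi>) = 0" by (simp_all add: complex_eq_iff)
    then have "cis (2 * \<psi>) = 1" by (simp add: complex_eq_iff)
    then have "(complex_of_real r * cis (- \<psi>))\<^sup>2 = 1"
      using \<open>r = 1\<close> by (simp add: power2_eq_square cis_mult complex_eq_iff)
    then show False using sub not_submaximal_if_square_eq_1 by blast
  qed
  then show "p \<in> ?S" using p r eq by simp
next
  fix p assume "p \<in> ?S"
  then obtain r u where p: "p = (r, u)" and r: "r > 0" "r \<noteq> 1" and u: "cmod u = 1"
    and eq: "\<alpha> / \<beta> * (1 - (complex_of_real r)\<^sup>2) = 1 + (complex_of_real r)\<^sup>2 * cnj u - 2 * u"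
    by blast
  \<comment> \<open>Half the argument of \<open>u\<close> serves as \<open>\<psi>\<close>; adding
    \<pi> to it would only change the sign of \<open>\<xi>\<close>.\<close>
  have "u = cis (2 * (Arg u / 2))"
    using u rcis_cmod_Arg[of u] by (simp add: rcis_def)
  then obtain \<psi> where \<psi>: "u = cis (2 * \<psi>)" by blast
  have "submaximal (complex_of_real r * cis (- \<psi>))"
    using r by (intro submaximal_if_norm_ne_1) (simp_all add: norm_mult)
  then show "p \<in> submaximal_branches \<alpha> \<beta> \<gamma> \<mu>"
    unfolding submaximal_branches_def
    using p \<psi> r eq solution_branch_polar_iff[OF assms r(1), of \<alpha> \<gamma> \<mu> \<psi>] by blast
qed

text \<open>With \<open>\<alpha> / \<beta> = p + i q\<close>, the cubic left after dividing the quartic by \<open>r\<^sup>2 - 1\<close> is linear in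
  \<open>q\<^sup>2\<close>; \<open>p = - 5 / 8\<close> and \<open>q\<^sup>2 = 375 / 64\<close> were found by a search for three rational roots.
  Below \<open>s = r\<^sup>2\<close> and \<open>u = x + i y\<close>.\<close>

lemma witness_squared_moduli:
  fixes s x y :: real
  assumes n: "x\<^sup>2 + y\<^sup>2 = 1" and c: "8 * (s - 2) * x = 5 * s - 13"
    and d: "8 * (s + 2) * y = 5 * sqrt 15 * (s - 1)"
  shows "s \<in> {1, 3, 16 / 7, 1 / 2}"
proof -
  \<comment> \<open>Multiplying \<open>n\<close> by \<open>64 * (s - 2)^2 * (s + 2)^2\<close> lets
    \<open>c\<close> and \<open>d\<close> eliminate \<open>x\<close> and \<open>y\<close>; 375 is
    the square of \<open>5 * sqrt 15\<close>.\<close>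
  have "(5 * s - 13)\<^sup>2 * (s + 2)\<^sup>2 + 375 * (s - 1)\<^sup>2 * (s - 2)\<^sup>2 =
      (5 * s - 13)\<^sup>2 * (s + 2)\<^sup>2 + (5 * sqrt 15 * (s - 1))\<^sup>2 * (s - 2)\<^sup>2"
    by (simp add: power_mult_distrib)
  also have "\<dots> = (8 * (s - 2) * x)\<^sup>2 * (s + 2)\<^sup>2 + (8 * (s + 2) * y)\<^sup>2 * (s - 2)\<^sup>2"
    by (simp only: c d)
  also have "\<dots> = 64 * (s - 2)\<^sup>2 * (s + 2)\<^sup>2 * (x\<^sup>2 + y\<^sup>2)"
    by algebra
  also have "\<dots> = 64 * (s - 2)\<^sup>2 * (s + 2)\<^sup>2"
    by (simp add: n)
  \<comment> \<open>The quartic splits over the rationals; \<open>s = 1\<close> is the spurious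
    root.\<close>
  finally have "24 * ((s - 1) * ((s - 3) * ((7 * s - 16) * (2 * s - 1)))) = 0"
    by algebra
  then have "s - 1 = 0 \<or> s - 3 = 0 \<or> 7 * s - 16 = 0 \<or> 2 * s - 1 = 0"
    by (simp only: mult_eq_0_iff zero_neq_numeral[symmetric] simp_thms)
  then show ?thesis by auto
qed

text \<open>Each admissible \<open>s = r^2\<close> determines \<open>u\<close>, with real part
  \<open>C s\<close> and imaginary part \<open>S s\<close>, so the branches correspond to the three
  roots other than 1.\<close>

lemma card_submaximal_branches_witness:
  defines "a \<equiv> Complex (- 5 / 8) (5 * sqrt 15 / 8)"
  shows "card (submaximal_branches a 1 \<gamma> \<mu>) = 3"
proof -
  define C :: "real \<Rightarrow> real" where "C = (\<lambda>s. (5 * s - 13) / (8 * (s - 2)))"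
  define S :: "real \<Rightarrow> real" where "S = (\<lambda>s. 5 * sqrt 15 * (s - 1) / (8 * (s + 2)))"
  define f where "f = (\<lambda>s. (sqrt s, Complex (C s) (S s)))"
  have mem: "(r, u) \<in> submaximal_branches a 1 \<gamma> \<mu> \<longleftrightarrow>
      r > 0 \<and> r \<noteq> 1 \<and> (Re u)\<^sup>2 + (Im u)\<^sup>2 = 1 \<and>
      8 * (r\<^sup>2 - 2) * Re u = 5 * r\<^sup>2 - 13 \<and> 8 * (r\<^sup>2 + 2) * Im u = 5 * sqrt 15 * (r\<^sup>2 - 1)" for r u
  proof -
    have "cmod u = 1 \<longleftrightarrow> (Re u)\<^sup>2 + (Im u)\<^sup>2 = 1"
      by (simp add: cmod_def real_sqrt_eq_1_iff)
    \<comment> \<open>Conjugation decouples the equation: on the right, \<open>Re u\<close> has the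
      factor \<open>r^2 - 2\<close> and \<open>Im u\<close> the factor
      \<open>- (r^2 + 2)\<close>.\<close>
    moreover have "a / 1 * (1 - (complex_of_real r)\<^sup>2) =
        1 + (complex_of_real r)\<^sup>2 * cnj u - 2 * u \<longleftrightarrow>
        8 * (r\<^sup>2 - 2) * Re u = 5 * r\<^sup>2 - 13 \<and> 8 * (r\<^sup>2 + 2) * Im u = 5 * sqrt 15 * (r\<^sup>2 - 1)"
      unfolding complex_eq_iff of_real_power[symmetric]
      by (simp add: a_def algebra_simps) linarith
    ultimately show ?thesis by (simp add: submaximal_branches_eq)
  qed
  have "submaximal_branches a 1 \<gamma> \<mu> = f ` {3, 16 / 7, 1 / 2}"
  proof (intro equalityI subsetI)
    fix p assume "p \<in> submaximal_branches a 1 \<gamma> \<mu>"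
    moreover obtain r u where p: "p = (r, u)" by fastforce
    ultimately have r: "r > 0" "r \<noteq> 1" and n: "(Re u)\<^sup>2 + (Im u)\<^sup>2 = 1"
      and c: "8 * (r\<^sup>2 - 2) * Re u = 5 * r\<^sup>2 - 13"
      and s: "8 * (r\<^sup>2 + 2) * Im u = 5 * sqrt 15 * (r\<^sup>2 - 1)"
      by (simp_all add: mem)
    have "r\<^sup>2 \<noteq> 1" using r by (simp add: power2_eq_1_iff)
    then have r2: "r\<^sup>2 \<in> {3, 16 / 7, 1 / 2}"
      using witness_squared_moduli[OF n c s] by simp
    \<comment> \<open>At \<open>r^2 = 2\<close> equation \<open>c\<close> would read
      \<open>0 = - 3\<close>.\<close>
    have "r\<^sup>2 \<noteq> 2" using c by auto
    moreover have "r\<^sup>2 + 2 \<noteq> 0" using zero_le_power2[of r] by linarith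
    ultimately have "Re u = C (r\<^sup>2)" "Im u = S (r\<^sup>2)"
      unfolding C_def S_def using c s by (simp_all add: nonzero_eq_divide_eq mult_ac)
    then have "p = f (r\<^sup>2)" using r by (simp add: p f_def complex_eq_iff)
    then show "p \<in> f ` {3, 16 / 7, 1 / 2}" using r2 by blast
  next
    \<comment> \<open>The values of \<open>u\<close> are \<open>(1 + i sqrt 15) / 4\<close>,
      \<open>(- 11 + 3 i sqrt 15) / 16\<close> and \<open>(7 - i sqrt 15) / 8\<close>, all of
      modulus 1.\<close>
    fix p assume "p \<in> f ` {3, 16 / 7, 1 / 2}"
    then show "p \<in> submaximal_branches a 1 \<gamma> \<mu>"
      by (auto simp: f_def mem C_def S_def power_mult_distrib power_divide)
  qed
  moreover have "inj_on f {3, 16 / 7, 1 / 2}" by (auto simp: f_def inj_on_def)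
  ultimately show ?thesis by (simp add: card_image)
qed

theorem mainTheorem3:
  shows "(\<forall>\<alpha> \<beta> \<gamma> \<mu> \<alpha>' \<beta>' \<gamma>' \<mu>' :: complex.
            \<beta> \<noteq> 0 \<and> \<beta>' \<noteq> 0 \<and> \<alpha> / \<beta> = \<alpha>' / \<beta>' \<longrightarrow>
            submaximal_branches \<alpha> \<beta> \<gamma> \<mu> = submaximal_branches \<alpha>' \<beta>' \<gamma>' \<mu>')
       \<and> (\<exists>\<alpha> \<beta> \<gamma> \<mu> :: complex. \<beta> \<noteq> 0 \<and> card (submaximal_branches \<alpha> \<beta> \<gamma> \<mu>) = 3)"
proof (intro conjI allI impI)
  fix \<alpha> \<beta> \<gamma> \<mu> \<alpha>' \<beta>' \<gamma>' \<mu>' :: complex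
  assume "\<beta> \<noteq> 0 \<and> \<beta>' \<noteq> 0 \<and> \<alpha> / \<beta> = \<alpha>' / \<beta>'"
  then show "submaximal_branches \<alpha> \<beta> \<gamma> \<mu> = submaximal_branches \<alpha>' \<beta>' \<gamma>' \<mu>'"
    by (simp add: submaximal_branches_eq)
next
  show "\<exists>\<alpha> \<beta> \<gamma> \<mu> :: complex. \<beta> \<noteq> 0 \<and> card (submaximal_branches \<alpha> \<beta> \<gamma> \<mu>) = 3"
    using card_submaximal_branches_witness one_neq_zero by blast
qed

end
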